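(* Let $G=(V,E)$ be a locally finite, connected, simple, unweighted $C_4$-free graph equipped with the non-normalized Laplacian $\Delta f(x)=\sum_{y\sim x}(f(y)-f(x))$. If $G$ satisfies $CD(0,\infty)$ and contains at least one triangle, then $G\cong C_3$ or $G\cong C_3'$.
   Context: $G$ is $C_4$-free if it contains no $4$-cycle as a subgraph. For $f,g:V\to\mathbb R$ define $2\Gamma(f,g)=\Delta(fg)-f\Delta g-g\Delta f$ and $2\Gamma_2(f,g)=\Delta\Gamma(f,g)-\Gamma(f,\Delta g)-\Gamma(\Delta f,g)$, $\Gamma_2(f)=\Gamma_2(f,f)$. $G$ satisfies $CD(0,\infty)$ if $\Gamma_2(f)(x)\ge0$ for all $f:V\to\mathbb R$ and all $x\in V$. $C_3'$ is the graph obtained from a triangle by attaching one pendant vertex (of degree $1$) to one vertex of the triangle. *)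

theory Defs
  imports Complex_Main
begin

type_synonym 'a graph = "'a set \<times> 'a set set"

definition verts :: "'a graph \<Rightarrow> 'a set" where
  "verts G = fst G"

definition edges :: "'a graph \<Rightarrow> 'a set set" where
  "edges G = snd G"

definition simple_graph :: "'a graph \<Rightarrow> bool" where
  "simple_graph G \<longleftrightarrow> (\<forall>e\<in>edges G. e \<subseteq> verts G \<and> card e = 2)"

definition adjacent :: "'a graph \<Rightarrow> 'a \<Rightarrow> 'a \<Rightarrow> bool" where
  "adjacent G x y \<longleftrightarrow> {x, y} \<in> edges G"

definition neighbours :: "'a graph \<Rightarrow> 'a \<Rightarrow> 'a set" where
  "neighbours G x = {y. adjacent G x y}"

definition locally_finite_graph :: "'a graph \<Rightarrow> bool" where
  "locally_finite_graph G \<longleftrightarrow> (\<forall>x\<in>verts G. finite (neighbours G x))"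

definition connected_graph :: "'a graph \<Rightarrow> bool" where
  "connected_graph G \<longleftrightarrow> (\<forall>x\<in>verts G. \<forall>y\<in>verts G. (adjacent G)\<^sup>*\<^sup>* x y)"

definition subgraph :: "'a graph \<Rightarrow> 'a graph \<Rightarrow> bool" where
  "subgraph H G \<longleftrightarrow> simple_graph H \<and> verts H \<subseteq> verts G \<and> edges H \<subseteq> edges G"

definition graph_isomorphic :: "'a graph \<Rightarrow> 'b graph \<Rightarrow> bool" where
  "graph_isomorphic G H \<longleftrightarrow>
     (\<exists>\<phi>. bij_betw \<phi> (verts G) (verts H) \<and>
          (\<forall>x\<in>verts G. \<forall>y\<in>verts G. adjacent G x y \<longleftrightarrow> adjacent H (\<phi> x) (\<phi> y)))"

definition contains_subgraph :: "'a graph \<Rightarrow> 'b graph \<Rightarrow> bool" where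
  "contains_subgraph G H \<longleftrightarrow> (\<exists>G'. subgraph G' G \<and> graph_isomorphic G' H)"

text \<open>The cycle on \<open>n\<close> vertices is meant for \<open>n \<ge> 3\<close> only.\<close>

definition cycle_graph :: "nat \<Rightarrow> nat graph" where
  "cycle_graph n = ({..<n}, {{i, Suc i mod n} | i. i < n})"

definition C3' :: "nat graph" where
  "C3' = ({0, 1, 2, 3}, {{0, 1}, {1, 2}, {0, 2}, {0, 3}})"

definition C4_free :: "'a graph \<Rightarrow> bool" where
  "C4_free G \<longleftrightarrow> \<not> contains_subgraph G (cycle_graph 4)"

text \<open>
  Functions on the vertex set are represented by functions on the whole type. In a simple graph
  neighbours of vertices are vertices, so at vertices the operators below depend only on the
  values of their arguments on the vertex set.
\<close>

definition laplacian :: "'a graph \<Rightarrow> ('a \<Rightarrow> real) \<Rightarrow> 'a \<Rightarrow> real" where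
  "laplacian G f x = (\<Sum>y\<in>neighbours G x. f y - f x)"

definition Gamma :: "'a graph \<Rightarrow> ('a \<Rightarrow> real) \<Rightarrow> ('a \<Rightarrow> real) \<Rightarrow> 'a \<Rightarrow> real" where
  "Gamma G f g x =
     (laplacian G (\<lambda>z. f z * g z) x - f x * laplacian G g x - g x * laplacian G f x) / 2"

definition Gamma2 :: "'a graph \<Rightarrow> ('a \<Rightarrow> real) \<Rightarrow> ('a \<Rightarrow> real) \<Rightarrow> 'a \<Rightarrow> real" where
  "Gamma2 G f g x =
     (laplacian G (Gamma G f g) x - Gamma G f (laplacian G g) x - Gamma G (laplacian G f) g x) / 2"

definition CD_0_infinity :: "'a graph \<Rightarrow> bool" where
  "CD_0_infinity G \<longleftrightarrow> (\<forall>f. \<forall>x\<in>verts G. Gamma2 G f f x \<ge> 0)"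

end

theory Submission
  imports Defs
begin

text \<open>
  Fix a vertex \<open>x\<close> of degree \<open>d\<close> and prescribe \<open>f = a\<close> on its neighbours, with \<open>f x = 0\<close>.
  In a \<open>C\<^sub>4\<close>-free graph each vertex at distance two from \<open>x\<close> has a unique neighbour \<open>u\<close> adjacent
  to \<open>x\<close>, so the values at distance two can be chosen independently; the optimal one is \<open>2 a(u)\<close>.
  If moreover \<open>a\<close> sums to zero and is constant along edges between neighbours of \<open>x\<close>, then
  \<open>4 \<Gamma>\<^sub>2(f)(x)\<close> equals the sum over \<open>u \<sim> x\<close> of \<open>a(u)\<^sup>2 (3 - d - d\<^sup>+(u))\<close>, where \<open>d\<^sup>+(u)\<close> counts
  the neighbours of \<open>u\<close> at distance two from \<open>x\<close>. If \<open>x, y, z\<close> is a triangle and \<open>d \<ge> 3\<close>, then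
  \<open>a = d - 2\<close> on \<open>y, z\<close> and \<open>a = -2\<close> on the other neighbours is admissible and nowhere zero,
  which forces \<open>d = 3\<close> and leaves no vertex at distance two from \<open>x\<close>.
\<close>

section \<open>Adjacency, 4-cycles and triangles\<close>

lemma adjacent_sym: "adjacent G x y \<longleftrightarrow> adjacent G y x"
  by (simp add: adjacent_def insert_commute)

lemma adjacent_irrefl: "simple_graph G \<Longrightarrow> \<not> adjacent G x x"
  by (auto simp: simple_graph_def adjacent_def)

lemma adjacent_verts: "simple_graph G \<Longrightarrow> adjacent G x y \<Longrightarrow> x \<in> verts G \<and> y \<in> verts G"
  by (auto simp: simple_graph_def adjacent_def)

lemma edges_cycle_graph: "edges (cycle_graph n) = (\<lambda>i. {i, Suc i mod n}) ` {..<n}"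
  by (auto simp: cycle_graph_def edges_def)

lemma adjacent_cycle_graph_3:
  "adjacent (cycle_graph 3) i j \<longleftrightarrow> i < 3 \<and> j < 3 \<and> i \<noteq> j"
proof -
  have "{..<3} = {0, 1, 2::nat}"
    by auto
  then have "edges (cycle_graph 3) = {{0, 1}, {1, 2}, {2, 0}}"
    by (simp add: edges_cycle_graph flip: numeral_2_eq_2)
  then show ?thesis
    by (simp add: adjacent_def doubleton_eq_iff) linarith
qed

lemma edges_cycle_graph_4: "edges (cycle_graph 4) = {{0, 1}, {1, 2}, {2, 3}, {3, 0}}"
proof -
  have "{..<4} = {0, 1, 2, 3::nat}"
    by auto
  then show ?thesis
    by (simp add: edges_cycle_graph flip: numeral_2_eq_2)
qed

text \<open>This puts \<open>C4_free\<close> into a directly usable form. Only the two diagonal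
  pairs must be assumed distinct, as adjacent vertices differ anyway. The witness \<open>H\<close>
  has just the four cycle edges, so chords in \<open>G\<close> do no harm.\<close>

lemma C4_free_no_4_cycle:
  assumes "simple_graph G" "C4_free G"
    and adj: "adjacent G a b" "adjacent G b c" "adjacent G c d" "adjacent G d a"
    and ne: "a \<noteq> c" "b \<noteq> d"
  shows False
proof -
  have ne': "a \<noteq> b" "b \<noteq> c" "c \<noteq> d" "d \<noteq> a"
    using adj adjacent_irrefl[OF assms(1)] by auto
  define H where "H = ({a, b, c, d}, {{a, b}, {b, c}, {c, d}, {d, a}})"
  define \<phi> :: "'a \<Rightarrow> nat" where
    "\<phi> = (\<lambda>v. if v = a then 0 else if v = b then 1 else if v = c then 2 else 3)"
  have \<phi>: "\<phi> a = 0" "\<phi> b = 1" "\<phi> c = 2" "\<phi> d = 3"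
    using ne ne' by (auto simp: \<phi>_def)
  have "subgraph H G"
    using adj adjacent_verts[OF assms(1)] ne'
    by (auto simp: subgraph_def simple_graph_def H_def verts_def edges_def adjacent_def)
  moreover have "bij_betw \<phi> (verts H) (verts (cycle_graph 4))"
  proof (rule bij_betw_imageI)
    show "inj_on \<phi> (verts H)"
      by (simp add: inj_on_def \<phi> H_def verts_def)
    show "\<phi> ` verts H = verts (cycle_graph 4)"
      by (auto simp: \<phi> H_def verts_def cycle_graph_def)
  qed
  moreover have "\<forall>u\<in>verts H. \<forall>v\<in>verts H.
      adjacent H u v \<longleftrightarrow> adjacent (cycle_graph 4) (\<phi> u) (\<phi> v)"
    using ne ne' ne[symmetric] ne'[symmetric]
    unfolding adjacent_def edges_cycle_graph_4
    by (simp add: H_def verts_def edges_def \<phi> doubleton_eq_iff)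
  ultimately show False
    using assms(2) unfolding C4_free_def contains_subgraph_def graph_isomorphic_def by blast
qed

lemma triangle_of_cycle_graph_3:
  assumes "contains_subgraph G (cycle_graph 3)"
  obtains x y z where "adjacent G x y" "adjacent G y z" "adjacent G x z"
proof -
  obtain H \<phi> where H: "subgraph H G" and bij: "bij_betw \<phi> (verts H) (verts (cycle_graph 3))"
    and iso: "\<forall>u\<in>verts H. \<forall>v\<in>verts H.
      adjacent H u v \<longleftrightarrow> adjacent (cycle_graph 3) (\<phi> u) (\<phi> v)"
    using assms by (auto simp: contains_subgraph_def graph_isomorphic_def)
  have "\<exists>v\<in>verts H. \<phi> v = i" if "i < 3" for i
  proof -
    have "i \<in> \<phi> ` verts H"
      using bij that by (simp add: bij_betw_def cycle_graph_def verts_def)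
    then show ?thesis
      by auto
  qed
  from this[of 0] this[of 1] this[of 2] obtain x y z
    where "x \<in> verts H" "y \<in> verts H" "z \<in> verts H" "\<phi> x = 0" "\<phi> y = 1" "\<phi> z = 2"
    by auto
  then have "adjacent H x y" "adjacent H y z" "adjacent H x z"
    using iso by (auto simp: adjacent_cycle_graph_3)
  then have "adjacent G x y" "adjacent G y z" "adjacent G x z"
    using H unfolding subgraph_def adjacent_def by blast+
  then show ?thesis
    by (rule that)
qed

section \<open>The operators at a vertex and the test-function inequality\<close>

lemma Gamma_eq:
  "Gamma G f g x = (\<Sum>y\<in>neighbours G x. (f y - f x) * (g y - g x)) / 2"
proof -
  have "laplacian G (\<lambda>z. f z * g z) x - f x * laplacian G g x - g x * laplacian G f x
      = (\<Sum>y\<in>neighbours G x. (f y * g y - f x * g x) - f x * (g y - g x) - g x * (f y - f x))"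
    by (simp add: laplacian_def sum_distrib_left sum_subtractf right_diff_distrib)
  also have "\<dots> = (\<Sum>y\<in>neighbours G x. (f y - f x) * (g y - g x))"
    by (rule sum.cong) (auto simp: algebra_simps)
  finally show ?thesis
    by (simp add: Gamma_def)
qed

text \<open>Taking \<open>f x = 0\<close> is a normalisation, since additive constants do not affect
  \<open>Gamma2\<close>. The product in the double sum is the factorisation of
  \<open>(f v - f u)^2 - 2 * f u * (f v - f u)\<close>, and only there do values at distance two
  from \<open>x\<close> enter.\<close>

lemma Gamma2_eq:
  assumes "f x = 0"
  shows "4 * Gamma2 G f f x =
    (\<Sum>u\<in>neighbours G x. \<Sum>v\<in>neighbours G u. (f v - f u) * (f v - 3 * f u))
    - real (card (neighbours G x)) * (\<Sum>u\<in>neighbours G x. (f u)\<^sup>2)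
    + 2 * (\<Sum>u\<in>neighbours G x. f u)\<^sup>2"
proof -
  let ?N = "neighbours G x"
  let ?S = "\<Sum>u\<in>?N. f u"
  have lap: "laplacian G f x = ?S"
    using assms by (simp add: laplacian_def)
  have gam: "Gamma G f f x = (\<Sum>u\<in>?N. (f u)\<^sup>2) / 2"
    using assms by (simp add: Gamma_eq power2_eq_square)
  have comm: "Gamma G (laplacian G f) f x = Gamma G f (laplacian G f) x"
    by (simp add: Gamma_eq mult.commute)
  \<comment> \<open>The square of the sum arises because \<open>laplacian G f x\<close> is itself
    the sum of \<open>f\<close> over the neighbours.\<close>
  have cross: "2 * Gamma G f (laplacian G f) x = (\<Sum>u\<in>?N. f u * laplacian G f u) - ?S\<^sup>2"
    using assms
    by (simp add: Gamma_eq lap right_diff_distrib sum_subtractf power2_eq_square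
        flip: sum_distrib_right)
  have "4 * Gamma2 G f f x =
      2 * laplacian G (Gamma G f f) x - 2 * (2 * Gamma G f (laplacian G f) x)"
    by (simp add: Gamma2_def comm)
  also have "\<dots> = (\<Sum>u\<in>?N. 2 * Gamma G f f u - 2 * (f u * laplacian G f u))
      - real (card ?N) * (\<Sum>u\<in>?N. (f u)\<^sup>2) + 2 * ?S\<^sup>2"
    unfolding cross
    by (simp add: laplacian_def[of G "Gamma G f f"] sum_subtractf gam sum_distrib_left
        algebra_simps)
  also have "(\<Sum>u\<in>?N. 2 * Gamma G f f u - 2 * (f u * laplacian G f u)) =
      (\<Sum>u\<in>?N. \<Sum>v\<in>neighbours G u. (f v - f u) * (f v - 3 * f u))"
  proof (rule sum.cong)
    fix u
    have "2 * Gamma G f f u - 2 * (f u * laplacian G f u) =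
        (\<Sum>v\<in>neighbours G u. (f v - f u) * (f v - f u) - 2 * (f u * (f v - f u)))"
      unfolding sum_subtractf by (simp add: Gamma_eq laplacian_def flip: sum_distrib_left)
    also have "\<dots> = (\<Sum>v\<in>neighbours G u. (f v - f u) * (f v - 3 * f u))"
      by (rule sum.cong) (auto simp: algebra_simps)
    finally show "2 * Gamma G f f u - 2 * (f u * laplacian G f u) =
        (\<Sum>v\<in>neighbours G u. (f v - f u) * (f v - 3 * f u))" .
  qed simp
  finally show ?thesis .
qed

text \<open>The inner sum of \<open>Gamma2_eq\<close> at a neighbour \<open>u\<close> has three
  parts: \<open>v = x\<close> gives \<open>3 * (a u)^2\<close>, common neighbours of
  \<open>u\<close> and \<open>x\<close> give 0 because \<open>a\<close> agrees there, and each
  vertex at distance two gives \<open>- (a u)^2\<close>. The zero sum of \<open>a\<close> removes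
  the last term of \<open>Gamma2_eq\<close>.\<close>

lemma CD_0_infinity_C4_free_sum_nonneg:
  assumes simple: "simple_graph G" and lf: "locally_finite_graph G" and C4: "C4_free G"
    and CD: "CD_0_infinity G" and x: "x \<in> verts G"
    and sum0: "(\<Sum>u\<in>neighbours G x. a u) = 0"
    and const: "\<And>u v. adjacent G x u \<Longrightarrow> adjacent G x v \<Longrightarrow> adjacent G u v \<Longrightarrow> a u = a v"
  shows "0 \<le> (\<Sum>u\<in>neighbours G x. (a u)\<^sup>2 *
    (3 - real (card (neighbours G x)) - real (card (neighbours G u - insert x (neighbours G x)))))"
proof -
  let ?N = "neighbours G x"
  \<comment> \<open>At distance two, \<open>SOME\<close> returns the unique middle vertex
    \<open>u\<close>, and \<open>t = 2 * a u\<close> minimises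
    \<open>(t - a u) * (t - 3 * a u)\<close>. Farther away the value is arbitrary and does not
    affect \<open>Gamma2\<close> at \<open>x\<close>.\<close>
  define f where "f v = (if v = x then 0 else if adjacent G x v then a v
    else 2 * a (SOME u. adjacent G x u \<and> adjacent G u v))" for v
  have f_nb: "f u = a u" if "u \<in> ?N" for u
    using that adjacent_irrefl[OF simple] by (auto simp: f_def neighbours_def)
  have inner: "(\<Sum>v\<in>neighbours G u. (f v - f u) * (f v - 3 * f u)) =
      (a u)\<^sup>2 * (3 - real (card (neighbours G u - insert x ?N)))" if u: "u \<in> ?N" for u
  proof -
    have xu: "adjacent G x u" "x \<in> neighbours G u"
      using u adjacent_sym[of G x u] by (auto simp: neighbours_def)
    have fin: "finite (neighbours G u)"
      using lf adjacent_verts[OF simple xu(1)] by (auto simp: locally_finite_graph_def)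
    have far: "f v = 2 * a u" if v: "v \<in> neighbours G u - insert x ?N" for v
    proof -
      have uv: "adjacent G u v" "v \<noteq> x" "\<not> adjacent G x v"
        using v by (auto simp: neighbours_def)
      \<comment> \<open>A second middle vertex \<open>u'\<close> would close the 4-cycle x, u, v,
        u'.\<close>
      have "u' = u" if "adjacent G x u'" "adjacent G u' v" for u'
        using C4_free_no_4_cycle[OF simple C4, of x u v u'] that uv xu adjacent_sym by metis
      then have "(SOME u. adjacent G x u \<and> adjacent G u v) = u"
        using uv xu by (intro some_equality) blast+
      then show ?thesis
        using uv by (simp add: f_def)
    qed
    have near: "f v = a u" if "v \<in> neighbours G u \<inter> ?N" for v
      using that const[OF xu(1), of v] f_nb[of v] by (auto simp: neighbours_def)
    have split: "neighbours G u = {x} \<union> (neighbours G u \<inter> ?N) \<union> (neighbours G u - insert x ?N)"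
      using xu by auto
    have "x \<notin> ?N"
      using adjacent_irrefl[OF simple] by (auto simp: neighbours_def)
    let ?h = "\<lambda>v. (f v - f u) * (f v - 3 * f u)"
    have "sum ?h (neighbours G u) =
        sum ?h {x} + sum ?h (neighbours G u \<inter> ?N) + sum ?h (neighbours G u - insert x ?N)"
      using fin \<open>x \<notin> ?N\<close>
      by (subst split, subst sum.union_disjoint) (auto simp: sum.union_disjoint)
    also have "sum ?h (neighbours G u \<inter> ?N) = 0"
      by (rule sum.neutral) (use near f_nb[OF u] in auto)
    also have "sum ?h (neighbours G u - insert x ?N) =
        (\<Sum>v\<in>neighbours G u - insert x ?N. - (a u)\<^sup>2)"
      by (rule sum.cong) (use far f_nb[OF u] in \<open>auto simp: power2_eq_square\<close>)
    also have "sum ?h {x} = 3 * (a u)\<^sup>2"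
      using f_nb[OF u] by (simp add: f_def power2_eq_square)
    finally show ?thesis
      by (simp add: algebra_simps)
  qed
  have "0 \<le> 4 * Gamma2 G f f x"
    using CD x by (simp add: CD_0_infinity_def)
  also have "\<dots> = (\<Sum>u\<in>?N. (a u)\<^sup>2 * (3 - real (card (neighbours G u - insert x ?N))))
      - real (card ?N) * (\<Sum>u\<in>?N. (a u)\<^sup>2)"
  proof -
    have "f x = 0"
      by (simp add: f_def)
    moreover have "(\<Sum>u\<in>?N. f u) = 0" "(\<Sum>u\<in>?N. (f u)\<^sup>2) = (\<Sum>u\<in>?N. (a u)\<^sup>2)"
      using sum0 f_nb by (simp_all cong: sum.cong)
    ultimately show ?thesis
      using sum.cong[OF refl inner] by (simp add: Gamma2_eq)
  qed
  also have "\<dots> = (\<Sum>u\<in>?N. (a u)\<^sup>2 *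
      (3 - real (card ?N) - real (card (neighbours G u - insert x ?N))))"
    by (simp add: sum_distrib_left algebra_simps sum_subtractf sum.distrib)
  finally show ?thesis .
qed

section \<open>The degree bound at a triangle vertex\<close>

lemma triangle_vertex_degree_ge_3:
  assumes simple: "simple_graph G" and lf: "locally_finite_graph G" and C4: "C4_free G"
    and CD: "CD_0_infinity G"
    and tri: "adjacent G x y" "adjacent G y z" "adjacent G x z"
    and deg: "card (neighbours G x) \<ge> 3"
  shows "card (neighbours G x) = 3"
    and "\<And>u. adjacent G x u \<Longrightarrow> neighbours G u \<subseteq> insert x (neighbours G x)"
proof -
  let ?N = "neighbours G x"
  let ?d = "real (card ?N)"
  let ?far = "\<lambda>u. neighbours G u - insert x ?N"
  \<comment> \<open>The total is 2(d - 2) from \<open>y\<close> and \<open>z\<close> against -2 from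
    each of the d - 2 other neighbours.\<close>
  define a where "a u = (if u \<in> {y, z} then ?d - 2 else -2)" for u
  have x: "x \<in> verts G"
    using adjacent_verts[OF simple tri(1)] by simp
  have fin: "finite ?N"
    using lf x by (auto simp: locally_finite_graph_def)
  have yz: "{y, z} \<subseteq> ?N" "y \<noteq> z"
    using tri adjacent_irrefl[OF simple] by (auto simp: neighbours_def)
  have "x \<noteq> y" "x \<noteq> z"
    using tri adjacent_irrefl[OF simple] by auto
  \<comment> \<open>An edge from \<open>v\<close> to \<open>y\<close> or \<open>z\<close> would give
    the 4-cycle x, v, y, z or x, v, z, y. Hence no edge between neighbours of \<open>x\<close> joins
    the two level sets of \<open>a\<close>.\<close>
  then have no_yz: False if "adjacent G x v" "v \<noteq> y" "v \<noteq> z" "adjacent G v y \<or> adjacent G v z" for v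
    using that C4_free_no_4_cycle[OF simple C4, of x v y z]
      C4_free_no_4_cycle[OF simple C4, of x v z y] tri adjacent_sym by metis
  have "(\<Sum>u\<in>?N. a u) = (\<Sum>u\<in>{y, z}. a u) + (\<Sum>u\<in>?N - {y, z}. a u)"
    using fin yz by (metis sum.subset_diff add.commute)
  also have "(\<Sum>u\<in>?N - {y, z}. a u) = (\<Sum>u\<in>?N - {y, z}. -2)"
    by (rule sum.cong) (auto simp: a_def)
  also have "\<dots> = -2 * (?d - 2)"
    using fin yz deg by (simp add: card_Diff_subset of_nat_diff)
  also have "(\<Sum>u\<in>{y, z}. a u) = 2 * (?d - 2)"
    using yz by (simp add: a_def)
  finally have sum0: "(\<Sum>u\<in>?N. a u) = 0"
    by simp
  have const: "a u = a v" if "adjacent G x u" "adjacent G x v" "adjacent G u v" for u v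
    using that no_yz[of u] no_yz[of v] adjacent_sym[of G u v] by (auto simp: a_def)
  have nz: "(a u)\<^sup>2 > 0" for u
    using deg by (auto simp: a_def)
  have nonneg: "0 \<le> (\<Sum>u\<in>?N. (a u)\<^sup>2 * (3 - ?d - real (card (?far u))))"
    by (rule CD_0_infinity_C4_free_sum_nonneg[OF simple lf C4 CD x sum0 const])
  \<comment> \<open>Since d \<ge> 3, every summand is \<le> 0 while the sum is \<ge> 0, so all
    summands vanish; the weights \<open>(a u)^2\<close> are positive.\<close>
  have zero: "3 - ?d - real (card (?far u)) = 0" if u: "u \<in> ?N" for u
  proof (rule ccontr)
    assume "3 - ?d - real (card (?far u)) \<noteq> 0"
    then have "(a u)\<^sup>2 * (3 - ?d - real (card (?far u))) < 0"
      using nz[of u] deg by (intro mult_pos_neg) auto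
    moreover have "(a v)\<^sup>2 * (3 - ?d - real (card (?far v))) \<le> 0" for v
      using deg by (intro mult_nonneg_nonpos) auto
    ultimately have "(\<Sum>u\<in>?N. (a u)\<^sup>2 * (3 - ?d - real (card (?far u)))) < (\<Sum>u\<in>?N. 0)"
      using fin u by (intro sum_strict_mono_ex1) auto
    then show False
      using nonneg by simp
  qed
  show "card ?N = 3"
    using zero[of y] yz deg by auto
  fix u assume u: "adjacent G x u"
  have "finite (neighbours G u)"
    using lf adjacent_verts[OF simple u] by (auto simp: locally_finite_graph_def)
  moreover have "card (?far u) = 0"
    using zero[of u] u deg by (auto simp: neighbours_def)
  ultimately show "neighbours G u \<subseteq> insert x ?N"
    by auto
qed

section \<open>Identification of the graph up to isomorphism\<close>

lemma connected_graph_verts_subset: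
  assumes "connected_graph G" "x \<in> verts G" "x \<in> S"
    and closed: "\<And>u v. u \<in> S \<Longrightarrow> adjacent G u v \<Longrightarrow> v \<in> S"
  shows "verts G \<subseteq> S"
proof
  fix v assume "v \<in> verts G"
  then have "(adjacent G)\<^sup>*\<^sup>* x v"
    using assms(1,2) by (auto simp: connected_graph_def)
  then show "v \<in> S"
    by induction (use assms(3) closed in auto)
qed

text \<open>The degree bound leaves exactly one further neighbour \<open>w\<close> of
  \<open>x\<close>, and no vertex lies at distance two. It remains to see that \<open>w\<close> is
  pendant.\<close>

lemma triangle_degree_ge_3_isomorphic_C3':
  assumes simple: "simple_graph G" and lf: "locally_finite_graph G"
    and conn: "connected_graph G" and C4: "C4_free G" and CD: "CD_0_infinity G"
    and tri: "adjacent G x y" "adjacent G y z" "adjacent G x z"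
    and deg: "card (neighbours G x) \<ge> 3"
  shows "graph_isomorphic G C3'"
proof -
  note irrefl = adjacent_irrefl[OF simple]
  note N = triangle_vertex_degree_ge_3[OF simple lf C4 CD tri deg]
  have ne: "x \<noteq> y" "y \<noteq> z" "x \<noteq> z"
    using tri irrefl by auto
  have "{y, z} \<subseteq> neighbours G x"
    using tri by (auto simp: neighbours_def)
  then have "card (neighbours G x - {y, z}) = 1"
    using N(1) ne by (simp add: card_Diff_subset)
  then obtain w where w: "neighbours G x - {y, z} = {w}"
    by (auto simp: card_1_singleton_iff)
  then have nb: "neighbours G x = {y, z, w}" and wne: "w \<noteq> y" "w \<noteq> z" and xw: "adjacent G x w"
    using tri by (auto simp: neighbours_def)
  have "w \<noteq> x"
    using xw irrefl by auto
  \<comment> \<open>Either edge would close a 4-cycle through \<open>x\<close> and all three of its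
    neighbours.\<close>
  have wyz: "\<not> adjacent G w y" "\<not> adjacent G w z"
    using C4_free_no_4_cycle[OF simple C4, of x w y z]
      C4_free_no_4_cycle[OF simple C4, of x w z y] tri xw ne wne adjacent_sym by metis+
  have V: "verts G = {x, y, z, w}"
  proof
    show "verts G \<subseteq> {x, y, z, w}"
    proof (rule connected_graph_verts_subset[OF conn, of x])
      show "x \<in> verts G"
        using adjacent_verts[OF simple tri(1)] by simp
    next
      fix u v assume "u \<in> {x, y, z, w}" "adjacent G u v"
      then show "v \<in> {x, y, z, w}"
        using N(2)[of u] nb tri xw by (auto simp: neighbours_def)
    qed simp
    show "{x, y, z, w} \<subseteq> verts G"
      using tri xw adjacent_verts[OF simple] by auto
  qed
  define \<phi> :: "'a \<Rightarrow> nat" where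
    "\<phi> = (\<lambda>v. if v = x then 0 else if v = y then 1 else if v = z then 2 else 3)"
  have \<phi>: "\<phi> x = 0" "\<phi> y = 1" "\<phi> z = 2" "\<phi> w = 3"
    using ne wne \<open>w \<noteq> x\<close> by (auto simp: \<phi>_def)
  have "bij_betw \<phi> (verts G) (verts C3')"
    unfolding V by (rule bij_betw_imageI) (auto simp: inj_on_def \<phi> C3'_def verts_def)
  moreover have "\<forall>u\<in>verts G. \<forall>v\<in>verts G. adjacent G u v \<longleftrightarrow> adjacent C3' (\<phi> u) (\<phi> v)"
  proof -
    have C: "adjacent C3' i j \<longleftrightarrow> {i, j} \<in> {{0, 1}, {1, 2}, {0, 2}, {0, 3}}" for i j
      by (simp add: adjacent_def C3'_def edges_def)
    have G: "adjacent G y x" "adjacent G z y" "adjacent G z x" "adjacent G w x"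
      "\<not> adjacent G y w" "\<not> adjacent G z w"
      using tri xw wyz adjacent_sym by metis+
    show ?thesis
      unfolding V C using tri xw wyz G irrefl by (simp add: \<phi> doubleton_eq_iff)
  qed
  ultimately show ?thesis
    by (auto simp: graph_isomorphic_def)
qed

text \<open>Each vertex of the triangle already has two neighbours on it, so the degree bound makes
  the triangle closed under adjacency, and connectedness makes it the whole graph.\<close>

lemma triangle_degrees_le_2_isomorphic_C3:
  assumes simple: "simple_graph G" and lf: "locally_finite_graph G" and conn: "connected_graph G"
    and tri: "adjacent G x y" "adjacent G y z" "adjacent G x z"
    and deg: "\<And>u. u \<in> {x, y, z} \<Longrightarrow> card (neighbours G u) \<le> 2"
  shows "graph_isomorphic G (cycle_graph 3)"
proof -
  have ne: "x \<noteq> y" "y \<noteq> z" "x \<noteq> z"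
    using tri adjacent_irrefl[OF simple] by auto
  have adj: "adjacent G u v" if "u \<in> {x, y, z}" "v \<in> {x, y, z}" "u \<noteq> v" for u v
    using that tri adjacent_sym[of G] by auto
  have nb: "neighbours G u = {x, y, z} - {u}" if u: "u \<in> {x, y, z}" for u
  proof (rule card_seteq[symmetric])
    show "finite (neighbours G u)"
      using lf u tri adjacent_verts[OF simple] by (auto simp: locally_finite_graph_def)
    show "{x, y, z} - {u} \<subseteq> neighbours G u"
      using adj[OF u] by (auto simp: neighbours_def)
    show "card (neighbours G u) \<le> card ({x, y, z} - {u})"
      using deg[OF u] u ne by (subst card_Diff_singleton) auto
  qed
  have V: "verts G = {x, y, z}"
  proof
    show "verts G \<subseteq> {x, y, z}"
    proof (rule connected_graph_verts_subset[OF conn, of x])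
      show "x \<in> verts G"
        using adjacent_verts[OF simple tri(1)] by simp
      show "v \<in> {x, y, z}" if "u \<in> {x, y, z}" "adjacent G u v" for u v
        using nb[OF that(1)] that(2) by (auto simp: neighbours_def)
    qed simp
    show "{x, y, z} \<subseteq> verts G"
      using tri adjacent_verts[OF simple] by auto
  qed
  define \<phi> :: "'a \<Rightarrow> nat" where "\<phi> = (\<lambda>v. if v = x then 0 else if v = y then 1 else 2)"
  have \<phi>: "\<phi> x = 0" "\<phi> y = 1" "\<phi> z = 2"
    using ne by (auto simp: \<phi>_def)
  have "bij_betw \<phi> (verts G) (verts (cycle_graph 3))"
    unfolding V by (rule bij_betw_imageI)
      (auto simp: inj_on_def \<phi> cycle_graph_def verts_def)
  moreover have "\<forall>u\<in>verts G. \<forall>v\<in>verts G.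
      adjacent G u v \<longleftrightarrow> adjacent (cycle_graph 3) (\<phi> u) (\<phi> v)"
    unfolding V adjacent_cycle_graph_3
    using tri tri[THEN adjacent_sym[THEN iffD1]] adjacent_irrefl[OF simple] by (simp add: \<phi>)
  ultimately show ?thesis
    by (auto simp: graph_isomorphic_def)
qed

theorem theorem3p1:
  fixes G :: "'a graph"
  assumes "simple_graph G"
    and "locally_finite_graph G"
    and "connected_graph G"
    and "C4_free G"
    and "CD_0_infinity G"
    and "contains_subgraph G (cycle_graph 3)"
  shows "graph_isomorphic G (cycle_graph 3) \<or> graph_isomorphic G C3'"
proof -
  obtain x y z where tri: "adjacent G x y" "adjacent G y z" "adjacent G x z"
    by (rule triangle_of_cycle_graph_3[OF assms(6)])
  note sym = tri[THEN adjacent_sym[THEN iffD1]]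
  note C3' = triangle_degree_ge_3_isomorphic_C3'[OF assms(1-5)]
  show ?thesis
  proof (cases "\<exists>u\<in>{x, y, z}. card (neighbours G u) \<ge> 3")
    case True
    then show ?thesis
      \<comment> \<open>The three instances read the triangle from \<open>x\<close>,
        \<open>y\<close> and \<open>z\<close> in turn, so any of them may be the vertex of large
        degree.\<close>
      using C3'[OF tri] C3'[OF sym(1) tri(3,2)] C3'[OF sym(3) tri(1) sym(2)] by blast
  next
    case False
    have "card (neighbours G u) \<le> 2" if "u \<in> {x, y, z}" for u
    proof -
      have "\<not> card (neighbours G u) \<ge> 3"
        using False that by blast
      then show ?thesis
        by simp
    qed
    then show ?thesis
      by (intro disjI1 triangle_degrees_le_2_isomorphic_C3[OF assms(1-3) tri])
  qed
qed

end
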